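(* Let $S$ and $K$ be two non-commutative subrings of a finite ring $R$ such that $S \subseteq K$. Then $$|E(\Gamma_{S,K})| \geq -\frac{3|S|^2}{16} + \frac{3|S||K|}{8}.$$
   Context: Rings are associative and not assumed to have a unity. For subrings $S \subseteq K$ of a finite ring $R$, put $C_K(S) = \{k \in K : ks = sk \ \forall s \in S\}$. The generalized non-commuting graph $\Gamma_{S,K}$ (for $S \subseteq K$) is the simple graph with vertex set $K \setminus C_K(S)$ in which two distinct vertices $a, b$ are adjacent if and only if ($a \in S$ or $b \in S$) and $ab \neq ba$; $E(\Gamma_{S,K})$ is its edge set. *)

theory Defs
  imports Complex_Main
begin

text \<open>The class \<open>ring\<close> is that of associative rings which need not have a unity;
  accordingly a subring is not required to contain one.\<close>

definition is_subring :: "'a::ring set \<Rightarrow> bool" where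
  "is_subring S \<longleftrightarrow>
     0 \<in> S \<and> (\<forall>x\<in>S. \<forall>y\<in>S. x - y \<in> S) \<and> (\<forall>x\<in>S. \<forall>y\<in>S. x * y \<in> S)"

definition noncommutative :: "'a::ring set \<Rightarrow> bool" where
  "noncommutative S \<longleftrightarrow> (\<exists>x\<in>S. \<exists>y\<in>S. x * y \<noteq> y * x)"

definition centralizer_in :: "'a::ring set \<Rightarrow> 'a set \<Rightarrow> 'a set" where
  "centralizer_in K S = {k \<in> K. \<forall>s\<in>S. k * s = s * k}"

definition gnc_vertices :: "'a::ring set \<Rightarrow> 'a set \<Rightarrow> 'a set" where
  "gnc_vertices S K = K - centralizer_in K S"

definition gnc_adj :: "'a::ring set \<Rightarrow> 'a \<Rightarrow> 'a \<Rightarrow> bool" where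
  "gnc_adj S a b \<longleftrightarrow> a \<noteq> b \<and> (a \<in> S \<or> b \<in> S) \<and> a * b \<noteq> b * a"

text \<open>The edges of the simple graph $\Gamma_{S,K}$ as unordered pairs of vertices, so that
  \<open>card\<close> counts each edge once.\<close>

definition gnc_edges :: "'a::ring set \<Rightarrow> 'a set \<Rightarrow> 'a set set" where
  "gnc_edges S K =
     {{a, b} | a b. a \<in> gnc_vertices S K \<and> b \<in> gnc_vertices S K \<and> gnc_adj S a b}"

end

theory Submission
  imports Defs
begin

text \<open>
  Each \<open>a \<in> S\<close> outside the centre \<open>Z\<close> of \<open>S\<close> contributes the edges to \<open>K - S\<close> in full and those
  inside \<open>S\<close> with weight 1/2, that is
  \<open>|K| - |C\<^sub>K(a)| - (|S| - |C\<^sub>S(a)|) / 2\<close>. Put \<open>y = |C\<^sub>K(a)| / |K| \<le> 1/2\<close>. Because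
  \<open>[S : C\<^sub>S(a)] \<le> [K : C\<^sub>K(a)]\<close>, the contribution is at least
  \<open>(1 - y) (|K| - |S| / 2) \<ge> (|K| - |S| / 2) / 2\<close>. Finally \<open>|Z| \<le> |S| / 4\<close>, since
  \<open>Z \<subset> C\<^sub>S(a) \<subset> S\<close> is a chain of proper additive subgroups for any noncentral \<open>a\<close>.
\<close>

definition add_subgroup :: "'a::ab_group_add set \<Rightarrow> bool" where
  "add_subgroup A \<longleftrightarrow> 0 \<in> A \<and> (\<forall>x\<in>A. \<forall>y\<in>A. x - y \<in> A)"

lemma add_subgroup_diff: "add_subgroup A \<Longrightarrow> x \<in> A \<Longrightarrow> y \<in> A \<Longrightarrow> x - y \<in> A"
  by (simp add: add_subgroup_def)

lemma add_subgroup_add: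
  assumes "add_subgroup A" "x \<in> A" "y \<in> A"
  shows "x + y \<in> A"
proof -
  have "x - (0 - y) \<in> A"
    using assms unfolding add_subgroup_def by blast
  then show ?thesis by simp
qed

lemma is_subring_add_subgroup: "is_subring S \<Longrightarrow> add_subgroup S"
  by (simp add: is_subring_def add_subgroup_def)

lemma add_subgroup_centralizer_in:
  assumes "add_subgroup K"
  shows "add_subgroup (centralizer_in K S)"
  using assms by (auto simp: add_subgroup_def centralizer_in_def left_diff_distrib right_diff_distrib)

text \<open>For \<open>x\<close> in \<open>A\<close> outside \<open>H\<close>, the coset
  \<open>x + H\<close> is disjoint from \<open>H\<close>, has the same size and lies in
  \<open>A\<close>.\<close>

lemma card_proper_add_subgroup:
  assumes "add_subgroup H" "add_subgroup A" "H \<subset> A" "finite A"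
  shows "2 * card H \<le> card A"
proof -
  obtain x where x: "x \<in> A" "x \<notin> H" using assms(3) by blast
  have disj: "H \<inter> (+) x ` H = {}"
  proof -
    have False if "h \<in> H" "x + h \<in> H" for h
      using add_subgroup_diff[OF assms(1) that(2,1)] x(2) by simp
    then show ?thesis by blast
  qed
  have fin: "finite H" using assms(3,4) finite_subset by blast
  have "H \<union> (+) x ` H \<subseteq> A"
    using assms(3) x(1) add_subgroup_add[OF assms(2)] by blast
  then have "card (H \<union> (+) x ` H) \<le> card A" using assms(4) by (rule card_mono[rotated])
  moreover have "card ((+) x ` H) = card H" by (simp add: card_image)
  ultimately show ?thesis using card_Un_disjoint[OF fin _ disj] fin by simp
qed

text \<open>\<open>A\<close> is the disjoint union of the fibres of \<open>f\<close>. This serves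
  twice: for addition on \<open>H \<times> S\<close>, and with \<open>n = 2\<close> for forgetting
  the order of a pair.\<close>

lemma card_le_mult_card_image:
  assumes "finite A" "\<And>y. y \<in> f ` A \<Longrightarrow> card {x \<in> A. f x = y} \<le> n"
  shows "card A \<le> n * card (f ` A)"
proof -
  have "card A = (\<Sum>y\<in>f ` A. card {x \<in> A. f x = y})"
    using sum.image_gen[OF assms(1), of "\<lambda>_. 1::nat" f] by simp
  also have "\<dots> \<le> (\<Sum>y\<in>f ` A. n)" by (rule sum_mono) (rule assms(2))
  finally show ?thesis by (simp add: mult.commute)
qed

text \<open>The index inequality \<open>[S : H \<inter> S] \<le> [K : H]\<close>, cleared of denominators.\<close>

lemma card_add_subgroups_mult_le:
  assumes "add_subgroup H" "add_subgroup S" "add_subgroup K" "H \<subseteq> K" "S \<subseteq> K" "finite K"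
  shows "card H * card S \<le> card (H \<inter> S) * card K"
proof -
  have fin: "finite H" "finite S" using assms(4-6) finite_subset by blast+
  define f where "f = (\<lambda>(h, s). h + s :: 'a)"
  have "card (H \<times> S) \<le> card (H \<inter> S) * card (f ` (H \<times> S))"
  proof (rule card_le_mult_card_image)
    show "finite (H \<times> S)" using fin by simp
    fix y assume "y \<in> f ` (H \<times> S)"
    then obtain h s where hs: "h \<in> H" "s \<in> S" "y = h + s" by (auto simp: f_def)
    \<comment> \<open>Two preimages of \<open>y\<close> differ by some \<open>(t, -t)\<close> with
      \<open>t\<close> in both \<open>H\<close> and \<open>S\<close>, so measuring first coordinates
      from \<open>h\<close> embeds the fibre into \<open>H \<inter> S\<close>.\<close>
    show "card {p \<in> H \<times> S. f p = y} \<le> card (H \<inter> S)"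
    proof (rule card_inj_on_le)
      show "inj_on (\<lambda>p. fst p - h) {p \<in> H \<times> S. f p = y}"
        by (auto simp: inj_on_def f_def)
      have "h' - h \<in> H \<inter> S" if "h' \<in> H" "s' \<in> S" "h' + s' = h + s" for h' s'
      proof -
        have "h' - h = s - s'" using that(3) by (simp add: algebra_simps)
        then show ?thesis
          using add_subgroup_diff[OF assms(1) that(1) hs(1)]
            add_subgroup_diff[OF assms(2) hs(2) that(2)] by simp
      qed
      then show "(\<lambda>p. fst p - h) ` {p \<in> H \<times> S. f p = y} \<subseteq> H \<inter> S"
        by (auto simp: f_def hs(3))
      show "finite (H \<inter> S)" using fin by simp
    qed
  qed
  also have "\<dots> \<le> card (H \<inter> S) * card K"
  proof -
    have "f ` (H \<times> S) \<subseteq> K"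
      using assms(4,5) add_subgroup_add[OF assms(3)] by (auto simp: f_def)
    then show ?thesis using card_mono[OF assms(6)] by simp
  qed
  finally show ?thesis by (simp add: card_cartesian_product)
qed

lemma card_centre_le:
  fixes S :: "'r::{ring,finite} set"
  assumes "add_subgroup S" "noncommutative S"
  shows "4 * card (centralizer_in S S) \<le> card S"
proof -
  obtain x y where xy: "x \<in> S" "y \<in> S" "x * y \<noteq> y * x"
    using assms(2) by (auto simp: noncommutative_def)
  \<comment> \<open>Both inclusions are strict because of the pair \<open>x\<close>,
    \<open>y\<close>: \<open>x\<close> commutes with itself but is not central, and \<open>y\<close>
    does not commute with \<open>x\<close>.\<close>
  have "centralizer_in S S \<subset> centralizer_in S {x}"
    using xy by (force simp: centralizer_in_def)
  moreover have "centralizer_in S {x} \<subset> S"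
    using xy by (force simp: centralizer_in_def)
  ultimately have "2 * card (centralizer_in S S) \<le> card (centralizer_in S {x})"
    "2 * card (centralizer_in S {x}) \<le> card S"
    using assms(1) by (simp_all add: card_proper_add_subgroup add_subgroup_centralizer_in)
  then show ?thesis by simp
qed

text \<open>An edge leaving \<open>S\<close> has a unique endpoint in \<open>S\<close>, so
  \<open>f\<close> is injective on \<open>P\<close>. An edge inside \<open>S\<close> may arise from
  both of its endpoints, so \<open>f\<close> is at most two-to-one on \<open>Q\<close>, whence the
  weight 1/2.\<close>

lemma card_gnc_edges_ge:
  fixes S K :: "'r::{ring,finite} set"
  assumes "S \<subseteq> K"
  shows "real (card (gnc_edges S K)) \<ge>
    (\<Sum>a\<in>S - centralizer_in S S. real (card (K - S - centralizer_in K {a}))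
      + real (card (S - centralizer_in K {a})) / 2)"
proof -
  let ?A = "S - centralizer_in S S"
  define P where "P = (SIGMA a:?A. K - S - centralizer_in K {a})"
  define Q where "Q = (SIGMA a:?A. S - centralizer_in K {a})"
  define f where "f = (\<lambda>(a, b). {a, b :: 'r})"
  have cP: "card P = (\<Sum>a\<in>?A. card (K - S - centralizer_in K {a}))"
    and cQ: "card Q = (\<Sum>a\<in>?A. card (S - centralizer_in K {a}))"
    by (simp_all add: P_def Q_def)
  have "card (f ` P) = card P"
  proof (rule card_image, rule inj_onI)
    fix p q assume "p \<in> P" "q \<in> P" "f p = f q"
    then have "fst p \<in> S" "snd p \<notin> S" "fst q \<in> S" "snd q \<notin> S" "{fst p, snd p} = {fst q, snd q}"
      by (auto simp: P_def f_def)
    then show "p = q" unfolding doubleton_eq_iff by (cases p; cases q) auto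
  qed
  moreover have "card Q \<le> 2 * card (f ` Q)"
  proof (rule card_le_mult_card_image)
    fix e assume "e \<in> f ` Q"
    then obtain a b where e: "e = {a, b}" by (auto simp: f_def)
    have "{p \<in> Q. f p = e} \<subseteq> {(a, b), (b, a)}"
    proof
      fix p assume "p \<in> {p \<in> Q. f p = e}"
      then have "{fst p, snd p} = {a, b}" by (simp add: f_def e case_prod_unfold)
      then show "p \<in> {(a, b), (b, a)}" unfolding doubleton_eq_iff by (cases p) auto
    qed
    then have "card {p \<in> Q. f p = e} \<le> card {(a, b), (b, a)}"
      by (intro card_mono) simp_all
    \<comment> \<open>Bounding by the length of a list avoids deciding whether
      \<open>a = b\<close>.\<close>
    also have "\<dots> \<le> 2" using card_length[of "[(a, b), (b, a)]"] by simp
    finally show "card {p \<in> Q. f p = e} \<le> 2" .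
  qed simp
  moreover have "card (f ` P \<union> f ` Q) = card (f ` P) + card (f ` Q)"
  proof (rule card_Un_disjoint)
    have "\<forall>e\<in>f ` P. \<not> e \<subseteq> S" "\<forall>e\<in>f ` Q. e \<subseteq> S"
      by (fastforce simp: f_def P_def Q_def)+
    then show "f ` P \<inter> f ` Q = {}" by blast
  qed simp_all
  moreover have "f ` P \<union> f ` Q \<subseteq> gnc_edges S K"
  proof -
    \<comment> \<open>Neither point lies in \<open>centralizer_in K S\<close>: \<open>a\<close> is
      noncentral in \<open>S\<close>, and \<open>b\<close> fails to commute with \<open>a\<close>,
      an element of \<open>S\<close>. The latter also forces \<open>a \<noteq> b\<close>.\<close>
    have "{a, b} \<in> gnc_edges S K" if "a \<in> ?A" "b \<in> K" "b \<notin> centralizer_in K {a}" for a b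
    proof -
      have "a \<in> gnc_vertices S K" "b \<in> gnc_vertices S K" "gnc_adj S a b"
        using that assms by (auto simp: gnc_vertices_def gnc_adj_def centralizer_in_def)
      then show ?thesis by (auto simp: gnc_edges_def)
    qed
    then have "f p \<in> gnc_edges S K" if "p \<in> P \<union> Q" for p
      using that assms by (cases p) (auto simp: f_def P_def Q_def)
    then show ?thesis by blast
  qed
  then have "card (f ` P \<union> f ` Q) \<le> card (gnc_edges S K)" by (intro card_mono) simp_all
  ultimately have "real (card P) + real (card Q) / 2 \<le> real (card (gnc_edges S K))"
    by linarith
  then show ?thesis
    by (simp add: cP cQ sum.distrib sum_divide_distrib)
qed

lemma noncentral_contribution_ge:
  fixes S K :: "'r::{ring,finite} set"
  assumes "add_subgroup S" "add_subgroup K" "S \<subseteq> K" "a \<in> S - centralizer_in S S"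
  shows "real (card (K - S - centralizer_in K {a})) + real (card (S - centralizer_in K {a})) / 2
    \<ge> real (card K) / 2 - real (card S) / 4"
proof -
  let ?H = "centralizer_in K {a}"
  define s k c d where "s = real (card S)" and "k = real (card K)"
    and "c = real (card ?H)" and "d = real (card (?H \<inter> S))"
  have H: "add_subgroup ?H" using assms(2) by (rule add_subgroup_centralizer_in)
  have HK: "?H \<subseteq> K" by (auto simp: centralizer_in_def)
  have "?H \<subset> K" using assms(3,4) by (force simp: centralizer_in_def)
  then have "2 * card ?H \<le> card K" using H assms(2) by (simp add: card_proper_add_subgroup)
  then have ck: "2 * c \<le> k" by (simp add: c_def k_def)
  have "card ?H * card S \<le> card (?H \<inter> S) * card K"
    using card_add_subgroups_mult_le[OF H assms(1,2) HK assms(3)] by simp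
  then have idx: "c * s \<le> d * k"
    unfolding c_def s_def d_def k_def by (metis of_nat_le_iff of_nat_mult)
  have sk: "s \<le> k" using assms(3) by (simp add: s_def k_def card_mono)
  have "0 \<in> K" using assms(2) by (simp add: add_subgroup_def)
  then have k0: "k > 0" by (auto simp: k_def card_gt_0_iff)
  have eS: "real (card (S - ?H)) = s - d"
  proof -
    have "card S = card (S - ?H) + card (?H \<inter> S)"
      using card_Int_Diff[of S ?H] by (simp add: Int_commute)
    then show ?thesis by (simp add: s_def d_def)
  qed
  have eK: "real (card (K - S - ?H)) = k - s - c + d"
  proof -
    have "K - S - ?H = K - (?H \<union> S)" by blast
    moreover have "K \<inter> (?H \<union> S) = ?H \<union> S" using HK assms(3) by blast
    ultimately have "card (K - S - ?H) + card (?H \<union> S) = card K"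
      using card_Int_Diff[of K "?H \<union> S"] by simp
    moreover have "card ?H + card S = card (?H \<union> S) + card (?H \<inter> S)"
      by (rule card_Un_Int) simp_all
    ultimately show ?thesis unfolding s_def k_def c_def d_def by linarith
  qed
  \<comment> \<open>Multiplying by \<open>k > 0\<close> keeps the estimate free of the quotient
    \<open>c / k\<close>.\<close>
  have "(k / 2 - s / 4) * k \<le> (k - s - c + d + (s - d) / 2) * k"
  proof -
    \<comment> \<open>With \<open>y = c / k\<close>, this is \<open>k\<close> times the gap
      \<open>(1/2 - y) (k - s / 2)\<close> between the two lower bounds for the
      contribution.\<close>
    have "0 \<le> (k / 2 - c) * (k - s / 2)"
      using ck sk k0 by (intro mult_nonneg_nonneg) simp_all
    then have "c * k + k * s / 4 \<le> c * s / 2 + k * k / 2"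
      by (simp add: algebra_simps)
    \<comment> \<open>The index inequality replaces \<open>c * s\<close> by
      \<open>d * k\<close>.\<close>
    then have "c * k + k * s / 4 \<le> d * k / 2 + k * k / 2"
      using idx by linarith
    then show ?thesis by (simp add: field_simps)
  qed
  then show ?thesis using k0 eS eK by (simp add: s_def k_def)
qed

theorem proposition4p9:
  fixes S K :: "'r::{ring,finite} set"
  assumes "is_subring S" and "is_subring K"
    and "noncommutative S" and "noncommutative K"
    and "S \<subseteq> K"
  shows "real (card (gnc_edges S K)) \<ge>
    - (3 * (real (card S))\<^sup>2 / 16) + 3 * real (card S) * real (card K) / 8"
proof -
  have S: "add_subgroup S" and K: "add_subgroup K"
    using assms(1,2) by (simp_all add: is_subring_add_subgroup)
  let ?Z = "centralizer_in S S"
  define s k where "s = real (card S)" and "k = real (card K)"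
  have sk: "s \<le> k" "s \<ge> 0" using assms(5) by (simp_all add: s_def k_def card_mono)
  have "card S = card (S - ?Z) + card ?Z"
  proof -
    have "S \<inter> ?Z = ?Z" by (auto simp: centralizer_in_def)
    then show ?thesis using card_Int_Diff[of S ?Z] by simp
  qed
  then have n: "real (card (S - ?Z)) \<ge> 3 * s / 4"
    using card_centre_le[OF S assms(3)] unfolding s_def by linarith
  \<comment> \<open>The left side expands to exactly the claimed bound. Since
    \<open>s \<le> k\<close>, the factor \<open>k / 2 - s / 4\<close> is nonnegative, so the lower
    bound on the number of noncentral elements may be inserted.\<close>
  have "3 * s / 4 * (k / 2 - s / 4) \<le> real (card (S - ?Z)) * (k / 2 - s / 4)"
    using n sk by (intro mult_right_mono) simp_all
  also have "\<dots> = (\<Sum>a\<in>S - ?Z. k / 2 - s / 4)" by simp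
  also have "\<dots> \<le> (\<Sum>a\<in>S - ?Z. real (card (K - S - centralizer_in K {a}))
      + real (card (S - centralizer_in K {a})) / 2)"
    unfolding s_def k_def by (intro sum_mono noncentral_contribution_ge S K assms(5))
  also have "\<dots> \<le> real (card (gnc_edges S K))" by (rule card_gnc_edges_ge[OF assms(5)])
  finally show ?thesis by (simp add: s_def k_def algebra_simps power2_eq_square)
qed

end
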